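(* Let $(\alpha_1,\dots,\alpha_n)$ be any $n$-tuple of real numbers such that $1,\alpha_1,\dots,\alpha_n$ are linearly independent over $\mathbb{Q}$. Let $T_1,\dots,T_n$ be any positive integers such that $T:=T_1\cdots T_n\ge 2$ and let $L\ge 2$ be a real number. Then $$\sum_{\substack{\mathbf q=(q_1,\dots,q_n)\in\mathbb{Z}^n\setminus\{\mathbf 0\}\\ |q_j|\le T_j\ (1\le j\le n)}}\min\Big\{L,\ \|q_1\alpha_1+\dots+q_n\alpha_n\|^{-1}\Big\}\ \ge\ 2T\min\{\log L,\log T\}+(2^{n+1}-2-\log 4)T+4.$$
   Context: $\|x\|$ denotes the distance from $x\in\mathbb{R}$ to the nearest integer, and $n\ge1$ is an integer. *)

theory Defs
  imports "HOL-Analysis.Analysis"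
begin

definition dist_nearest_int :: "real \<Rightarrow> real"
  where "dist_nearest_int x = \<bar>x - of_int (round x)\<bar>"

lemma dist_nearest_int_eq_infdist: "dist_nearest_int x = infdist x \<int>"
proof (rule antisym)
  show "dist_nearest_int x \<le> infdist x \<int>"
  proof -
    have "dist_nearest_int x \<le> dist x a" if "a \<in> \<int>" for a
      using that round_diff_minimal[of x]
      by (auto simp: dist_nearest_int_def dist_real_def elim!: Ints_cases)
    moreover have "(\<int> :: real set) \<noteq> {}" by auto
    ultimately show ?thesis
      by (auto simp: infdist_def intro!: cINF_greatest)
  qed
  show "infdist x \<int> \<le> dist_nearest_int x"
    using infdist_le[of "of_int (round x)" "\<int>" x]
    by (simp add: dist_nearest_int_def dist_real_def)
qed

lemma vector_space_rat_real: "vector_space (\<lambda>(c::rat) (x::real). of_rat c * x)"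
  by unfold_locales (auto simp: algebra_simps of_rat_add of_rat_mult)

text \<open>The library notion of independence concerns sets; for a family, injectivity has to be
  required as well, since repeated entries are linearly dependent.\<close>

definition rat_lin_indep_family :: "('i \<Rightarrow> real) \<Rightarrow> 'i set \<Rightarrow> bool"
  where "rat_lin_indep_family v I \<longleftrightarrow> 
    inj_on v I \<and> module.independent (\<lambda>(c::rat) (x::real). of_rat c * x) (v ` I)"

lemma rat_lin_indep_family_iff:
  assumes "finite I"
  shows "rat_lin_indep_family v I \<longleftrightarrow>
    (\<forall>c :: 'i \<Rightarrow> rat. (\<Sum>i\<in>I. of_rat (c i) * v i) = 0 \<longrightarrow> (\<forall>i\<in>I. c i = 0))"
    (is "?L \<longleftrightarrow> ?R")
proof -
  interpret rat_real: vector_space "\<lambda>(c::rat) (x::real). of_rat c * x"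
    by (rule vector_space_rat_real)
  show ?thesis
  proof
    assume L: ?L
    hence inj: "inj_on v I" and ind: "rat_real.independent (v ` I)"
      by (auto simp: rat_lin_indep_family_def)
    show ?R
    proof (intro allI impI ballI)
      fix c :: "'i \<Rightarrow> rat" and i
      assume s: "(\<Sum>i\<in>I. of_rat (c i) * v i) = 0" and i: "i \<in> I"
      define u where "u = c \<circ> inv_into I v"
      have u: "u (v j) = c j" if "j \<in> I" for j
        using that inj by (simp add: u_def)
      have "(\<Sum>x\<in>v ` I. of_rat (u x) * x) = (\<Sum>i\<in>I. of_rat (c i) * v i)"
        using inj u by (simp add: sum.reindex)
      with s have "(\<Sum>x\<in>v ` I. of_rat (u x) * x) = 0" by simp
      from rat_real.independentD[OF ind _ order_refl this, of "v i"] i assms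
      have "u (v i) = 0" by simp
      with u i show "c i = 0" by simp
    qed
  next
    assume R: ?R
    have inj: "inj_on v I"
    proof (rule inj_onI, rule ccontr)
      fix i j assume ij: "i \<in> I" "j \<in> I" "v i = v j" "i \<noteq> j"
      define c :: "'i \<Rightarrow> rat" where "c = (\<lambda>k. if k = i then 1 else if k = j then - 1 else 0)"
      have "(\<Sum>k\<in>I. of_rat (c k) * v k) = (\<Sum>k\<in>{i, j}. of_rat (c k) * v k)"
        using assms ij by (intro sum.mono_neutral_right) (auto simp: c_def)
      also have "\<dots> = 0" using ij by (auto simp: c_def of_rat_minus)
      finally have "c i = 0" using R ij by blast
      thus False by (simp add: c_def)
    qed
    have "rat_real.independent (v ` I)"
    proof
      assume "rat_real.dependent (v ` I)"
      then obtain u x where u: "(\<Sum>x\<in>v ` I. of_rat (u x) * x) = 0" "x \<in> v ` I" "u x \<noteq> 0"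
        using rat_real.dependent_finite[of "v ` I"] assms by auto
      have "(\<Sum>i\<in>I. of_rat (u (v i)) * v i) = 0"
        using u(1) inj by (simp add: sum.reindex)
      with R[rule_format, of "\<lambda>i. u (v i)"] have "\<forall>i\<in>I. u (v i) = 0" by simp
      with u show False by auto
    qed
    with inj show ?L by (simp add: rat_lin_indep_family_def)
  qed
qed

text \<open>Integer tuples \<open>(q 1, \<dots>, q n)\<close> are the functions that are extensional on
  \<open>{1..n}\<close>, so that each tuple is represented exactly once.\<close>

definition nonzero_box :: "nat \<Rightarrow> (nat \<Rightarrow> nat) \<Rightarrow> (nat \<Rightarrow> int) set"
  where "nonzero_box n T =
    {q \<in> {1..n} \<rightarrow>\<^sub>E UNIV. (\<exists>j\<in>{1..n}. q j \<noteq> 0) \<and> (\<forall>j\<in>{1..n}. \<bar>q j\<bar> \<le> int (T j))}"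

text \<open>Without finiteness the sum over this set would be 0 by convention.\<close>

lemma finite_nonzero_box: "finite (nonzero_box n T)"
proof (rule finite_subset)
  show "nonzero_box n T \<subseteq> {1..n} \<rightarrow>\<^sub>E {- int (Max (T ` {1..n})) .. int (Max (T ` {1..n}))}"
  proof
    fix q assume q: "q \<in> nonzero_box n T"
    have "\<bar>q j\<bar> \<le> int (Max (T ` {1..n}))" if "j \<in> {1..n}" for j
    proof -
      have "\<bar>q j\<bar> \<le> int (T j)" using q that by (auto simp: nonzero_box_def)
      also have "T j \<le> Max (T ` {1..n})" using that by (intro Max_ge) auto
      finally show ?thesis by simp
    qed
    with q show "q \<in> {1..n} \<rightarrow>\<^sub>E {- int (Max (T ` {1..n})) .. int (Max (T ` {1..n}))}"
      unfolding PiE_iff nonzero_box_def atLeastAtMost_iff abs_le_iff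
      by (simp add: minus_le_iff)
  qed
qed (intro finite_PiE; simp)

end

theory Submission
  imports Defs
begin

text \<open>Write \<open>K = min L T\<close> and \<open>\<parallel>x\<parallel>\<close> for \<open>dist_nearest_int x\<close>. Since \<open>\<parallel>q \<cdot> \<alpha>\<parallel>\<close> lies in
  \<open>(0, 1/2]\<close> (it is positive by linear independence), the layer-cake formula
  \<open>min K y = 2 + \<integral>\<^sub>2\<^sup>K [t \<le> y] dt\<close> for \<open>y \<ge> 2\<close> bounds the sum from below by
  \<open>2 N + \<integral>\<^sub>2\<^sup>K c(t) dt\<close>, where \<open>N\<close> is the number of nonzero points of the box and
  \<open>c(t)\<close> counts those with \<open>\<parallel>q \<cdot> \<alpha>\<parallel> \<le> 1/t\<close>.

  The count is a sharpened Dirichlet pigeonhole. Among the \<open>T\<close> points \<open>p \<cdot> \<alpha>\<close> with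
  \<open>1 \<le> p\<^sub>j \<le> T\<^sub>j\<close> on the circle, some closed arc of length \<open>1/t\<close> holds at least the
  average number \<open>T/t\<close>. Subtracting from each of them the first point of that arc gives at
  least \<open>T/t - 1\<close> nonzero \<open>q\<close> in the box for which \<open>q \<cdot> \<alpha>\<close> lies at most \<open>1/t\<close> to the right of an
  integer; their negatives lie to the left of an integer and, as \<open>1/t \<le> 1/2\<close>, are different. So
  \<open>c(t) \<ge> 2 (T/t - 1)\<close> (lemma \<open>card_small_dist_ge\<close>).

  Integrating gives \<open>2 T ln (K/2) - 2 (K - 2)\<close>, and
  \<open>2 N = 2 \<Prod>(2 T\<^sub>j + 1) - 2 \<ge> 2\<^sup>n\<^sup>+\<^sup>1 T\<close>. As \<open>K \<le> T\<close>, these add up to the claimed bound.\<close>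

section \<open>Distance to the nearest integer and fractional parts\<close>

lemma dist_nearest_int_le: "dist_nearest_int x \<le> \<bar>x - of_int m\<bar>"
  unfolding dist_nearest_int_def using round_diff_minimal[of x m] by simp

lemma dist_nearest_int_le_half: "dist_nearest_int x \<le> 1 / 2"
  unfolding dist_nearest_int_def using of_int_round_abs_le[of x] by (simp add: abs_minus_commute)

lemma dist_nearest_int_pos: "x \<notin> \<int> \<Longrightarrow> dist_nearest_int x > 0"
  unfolding dist_nearest_int_def by (metis Ints_of_int eq_iff_diff_eq_0 zero_less_abs_iff)

lemma dist_nearest_int_le_frac: "dist_nearest_int x \<le> frac x"
  using dist_nearest_int_le[of x "\<lfloor>x\<rfloor>"] frac_ge_0[of x] by (simp add: frac_def)

lemma dist_nearest_int_minus_le_frac: "dist_nearest_int (- x) \<le> frac x"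
  using dist_nearest_int_le[of "- x" "- \<lfloor>x\<rfloor>"] frac_ge_0[of x] by (simp add: frac_def)

section \<open>Averaging over arcs of the circle\<close>

lemma has_integral_indicator_interval:
  fixes a b u v :: real
  assumes "a \<le> b"
  shows "((\<lambda>t. if u \<le> t \<and> t \<le> v then 1 else 0) has_integral
           max 0 (min b v - max a u)) {a..b}"
proof -
  have "((\<lambda>_. 1::real) has_integral max 0 (min b v - max a u)) {max a u..min b v}"
  proof (cases "max a u \<le> min b v")
    case True
    then show ?thesis using has_integral_const_real[of "1::real" "max a u" "min b v"]
      by (simp add: max_def)
  next
    case False
    then show ?thesis by (auto simp: max_def min_def)
  qed
  then have "((\<lambda>t. if t \<in> {max a u..min b v} then 1::real else 0) has_integral
           max 0 (min b v - max a u)) {a..b}"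
    by (subst has_integral_restrict) auto
  then show ?thesis
    by (rule has_integral_eq[rotated]) auto
qed

text \<open>Rotating the circle preserves length, so the set of \<open>s\<close> for which \<open>x\<close> lies in the arc of
  length \<open>h\<close> starting at \<open>s\<close> has measure \<open>h\<close>. On \<open>[0, 1]\<close> that set is the trace of the two
  translates \<open>[x - h, x]\<close> and \<open>[x + 1 - h, x + 1]\<close> of one interval.\<close>

lemma has_integral_frac_le:
  fixes x h :: real
  assumes "0 < h" "h < 1"
  shows "((\<lambda>s. if frac (x - s) \<le> h then 1 else 0) has_integral h) {0..1}"
proof -
  define y where "y = frac x"
  have y: "0 \<le> y" "y < 1" unfolding y_def by (simp_all add: frac_lt_1)
  let ?I = "\<lambda>u v t::real. if u \<le> t \<and> t \<le> v then 1 else 0::real"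
  have I: "((\<lambda>s. ?I (y - h) y s + ?I (y + 1 - h) (y + 1) s) has_integral
      max 0 (min 1 y - max 0 (y - h)) + max 0 (min 1 (y + 1) - max 0 (y + 1 - h))) {0..1}"
    by (intro has_integral_add has_integral_indicator_interval) auto
  have val: "max 0 (min 1 y - max 0 (y - h)) + max 0 (min 1 (y + 1) - max 0 (y + 1 - h)) = h"
    using y assms by (auto simp: max_def min_def)
  have shift: "frac (x - s) = frac (y - s)" for s
  proof -
    have "y - s = (x - s) + of_int (- \<lfloor>x\<rfloor>)" by (simp add: y_def frac_def)
    then show ?thesis by (metis frac_add_of_int_right)
  qed
  have "?I (y - h) y s + ?I (y + 1 - h) (y + 1) s = (if frac (x - s) \<le> h then 1 else 0)"
    if s: "s \<in> {0..1}" for s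
  proof (cases "s \<le> y")
    case True
    then have "frac (y - s) = y - s" using s y by (simp add: frac_eq)
    then show ?thesis using True assms by (auto simp: shift)
  next
    case False
    have "frac (y - s) = frac (y - s + 1)" by (rule frac_1_eq[symmetric])
    also have "\<dots> = y - s + 1" using s y False by (simp add: frac_eq)
    finally show ?thesis using False assms s y by (auto simp: shift)
  qed
  then show ?thesis using I unfolding val by (rule has_integral_eq)
qed

lemma ex_arc_card_ge:
  fixes f :: "'a \<Rightarrow> real"
  assumes A: "finite A" and h: "0 < h" "h < 1"
  shows "\<exists>s. h * real (card A) \<le> real (card {p \<in> A. frac (f p - s) \<le> h})"
proof (rule ccontr)
  define c where "c = (\<lambda>s. card {p \<in> A. frac (f p - s) \<le> h})"
  assume "\<not> ?thesis"
  then have less: "real (c s) < h * real (card A)" for s by (auto simp: c_def not_le)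
  \<comment> \<open>The count is an integer, so it is bounded away from the average uniformly in \<open>s\<close>.\<close>
  have "real (c s) \<le> of_int (\<lceil>h * real (card A)\<rceil> - 1)" for s
  proof -
    have "int (c s) < \<lceil>h * real (card A)\<rceil>" using less[of s] by (simp add: less_ceiling_iff)
    then show ?thesis by linarith
  qed
  moreover have "((\<lambda>s. \<Sum>p\<in>A. if frac (f p - s) \<le> h then 1 else 0) has_integral (\<Sum>p\<in>A. h)) {0..1}"
    using A by (intro has_integral_sum has_integral_frac_le h)
  moreover have "(\<Sum>p\<in>A. if frac (f p - s) \<le> h then 1 else 0) = real (c s)" for s
    using A by (simp add: c_def sum.If_cases Int_def)
  ultimately have "real (card A) * h \<le> of_int (\<lceil>h * real (card A)\<rceil> - 1)"
    using has_integral_le[of "\<lambda>s. real (c s)" "real (card A) * h" "{0..1::real}"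
        "\<lambda>_. of_int (\<lceil>h * real (card A)\<rceil> - 1)" "of_int (\<lceil>h * real (card A)\<rceil> - 1)"]
      has_integral_const_real[of "of_int (\<lceil>h * real (card A)\<rceil> - 1) :: real" 0 1]
    by simp
  then show False by (simp add: mult.commute) linarith
qed

text \<open>The arc may be taken to start at one of the points: move its left end to the right until
  it meets the first point.\<close>

lemma ex_arc_from_point_card_ge:
  fixes f :: "'a \<Rightarrow> real"
  assumes A: "finite A" "A \<noteq> {}" and h: "0 < h" "h < 1"
  shows "\<exists>a\<in>A. h * real (card A) \<le> real (card {p \<in> A. frac (f p - f a) \<le> h})"
proof -
  obtain s where s: "h * real (card A) \<le> real (card {p \<in> A. frac (f p - s) \<le> h})"
    using ex_arc_card_ge[OF A(1) h] by blast
  let ?D = "{p \<in> A. frac (f p - s) \<le> h}"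
  have "0 < h * real (card A)" using A h by (simp add: card_gt_0_iff)
  with s have "?D \<noteq> {}" by (metis card.empty not_le of_nat_0)
  moreover have "finite ?D" using A by simp
  ultimately obtain a where a: "a \<in> ?D"
    and min: "\<And>p. p \<in> ?D \<Longrightarrow> frac (f a - s) \<le> frac (f p - s)"
    using arg_min_if_finite(1)[of ?D "\<lambda>p. frac (f p - s)"]
      arg_min_least[of ?D _ "\<lambda>p. frac (f p - s)"] by blast
  have "?D \<subseteq> {p \<in> A. frac (f p - f a) \<le> h}"
  proof safe
    fix p assume p: "p \<in> A" "frac (f p - s) \<le> h"
    have "frac (f p - f a) = frac ((f p - s) - (f a - s))" by simp
    also have "\<dots> = frac (f p - s) - frac (f a - s)"
      by (rule frac_diff_pos) (use min p in simp)
    also have "\<dots> \<le> frac (f p - s)" using frac_ge_0[of "f a - s"] by linarith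
    finally show "frac (f p - f a) \<le> h" using p by simp
  qed
  then have "card ?D \<le> card {p \<in> A. frac (f p - f a) \<le> h}" using A by (intro card_mono) auto
  then show ?thesis using a s by (intro bexI[of _ a]) auto
qed

section \<open>Counting small values of the linear form\<close>

lemma linear_form_notin_Ints:
  fixes \<alpha> :: "nat \<Rightarrow> real" and q :: "nat \<Rightarrow> int"
  assumes ind: "rat_lin_indep_family (\<lambda>j. if j = 0 then 1 else \<alpha> j) {0..n}"
    and j: "j \<in> {1..n}" "q j \<noteq> 0"
  shows "(\<Sum>j=1..n. of_int (q j) * \<alpha> j) \<notin> \<int>"
proof
  assume "(\<Sum>j=1..n. of_int (q j) * \<alpha> j) \<in> \<int>"
  then obtain m where m: "(\<Sum>j=1..n. of_int (q j) * \<alpha> j) = of_int m" by (auto elim: Ints_cases)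
  define c :: "nat \<Rightarrow> rat" where "c = (\<lambda>i. if i = 0 then of_int (- m) else of_int (q i))"
  have "(\<Sum>i\<in>{0..n}. of_rat (c i) * (if i = 0 then 1 else \<alpha> i))
      = of_int (- m) + (\<Sum>i=1..n. of_int (q i) * \<alpha> i)"
    by (subst sum.atLeast_Suc_atMost) (auto simp: c_def of_rat_minus intro!: sum.cong)
  then have "(\<Sum>i\<in>{0..n}. of_rat (c i) * (if i = 0 then 1 else \<alpha> i)) = 0" using m by simp
  then have "\<forall>i\<in>{0..n}. c i = 0" using ind by (simp add: rat_lin_indep_family_iff)
  then have "c j = 0" using j by auto
  then show False using j by (simp add: c_def)
qed

lemma nonzero_box_uminus:
  assumes "q \<in> nonzero_box n T"
  shows "(\<lambda>j\<in>{1..n}. - q j) \<in> nonzero_box n T"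
  using assms by (auto simp: nonzero_box_def)

lemma inj_on_uminus_nonzero_box: "inj_on (\<lambda>q. \<lambda>j\<in>{1..n}. - q j) (nonzero_box n T)"
proof (rule inj_onI)
  fix p q assume pq: "p \<in> nonzero_box n T" "q \<in> nonzero_box n T"
    and eq: "(\<lambda>j\<in>{1..n}. - p j) = (\<lambda>j\<in>{1..n}. - q j)"
  have "p j = q j" if "j \<in> {1..n}" for j using fun_cong[OF eq, of j] that by simp
  moreover have "p \<in> {1..n} \<rightarrow>\<^sub>E UNIV" "q \<in> {1..n} \<rightarrow>\<^sub>E UNIV"
    using pq unfolding nonzero_box_def by blast+
  ultimately show "p = q" by (intro PiE_ext)
qed

text \<open>The arc is applied to the corner box \<open>1 \<le> p\<^sub>j \<le> T\<^sub>j\<close>, whose difference set lies in the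
  symmetric box; the \<open>- 1\<close> is the base point of the arc, which gives the zero difference.\<close>

lemma card_small_frac_ge:
  fixes n :: nat and \<alpha> :: "nat \<Rightarrow> real" and h :: real
  defines "\<phi> \<equiv> \<lambda>q. \<Sum>j=1..n. of_int (q j) * \<alpha> j"
  assumes T: "\<And>j. j \<in> {1..n} \<Longrightarrow> T j > 0" and h: "0 < h" "h < 1"
  shows "h * real (\<Prod>j=1..n. T j) - 1 \<le> real (card {q \<in> nonzero_box n T. frac (\<phi> q) \<le> h})"
proof -
  define B where "B = (\<Pi>\<^sub>E j\<in>{1..n}. {1..int (T j)})"
  have B: "finite B" "card B = (\<Prod>j=1..n. T j)"
    by (auto simp: B_def card_PiE intro!: finite_PiE)
  moreover have "(\<Prod>j=1..n. T j) > 0" using T by (intro prod_pos) blast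
  ultimately have "B \<noteq> {}" by force
  then obtain a where a: "a \<in> B"
    and ge: "h * real (card B) \<le> real (card {p \<in> B. frac (\<phi> p - \<phi> a) \<le> h})"
    using ex_arc_from_point_card_ge[OF B(1) _ h, of \<phi>] by blast
  let ?D = "{p \<in> B. frac (\<phi> p - \<phi> a) \<le> h}"
  let ?g = "\<lambda>p. \<lambda>j\<in>{1..n}. p j - a j"
  have "?g ` (?D - {a}) \<subseteq> {q \<in> nonzero_box n T. frac (\<phi> q) \<le> h}"
  proof (intro image_subsetI CollectI conjI)
    fix p assume p: "p \<in> ?D - {a}"
    have "\<exists>j\<in>{1..n}. p j \<noteq> a j"
      using p a PiE_ext[of p "{1..n}" _ a] unfolding B_def by blast
    moreover have "\<bar>p j - a j\<bar> \<le> int (T j)" if "j \<in> {1..n}" for j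
    proof -
      have "p j \<in> {1..int (T j)}" "a j \<in> {1..int (T j)}" using p a that by (auto simp: B_def)
      then show ?thesis by auto
    qed
    ultimately show "?g p \<in> nonzero_box n T" by (auto simp: nonzero_box_def)
    have "\<phi> (?g p) = \<phi> p - \<phi> a"
      by (simp add: \<phi>_def sum_subtractf[symmetric] algebra_simps)
    then show "frac (\<phi> (?g p)) \<le> h" using p by simp
  qed
  moreover have "inj_on ?g (?D - {a})"
  proof (rule inj_onI)
    fix p r assume pr: "p \<in> ?D - {a}" "r \<in> ?D - {a}" and eq: "?g p = ?g r"
    have "p j = r j" if "j \<in> {1..n}" for j using fun_cong[OF eq, of j] that by simp
    moreover have "p \<in> B" "r \<in> B" using pr by blast+
    ultimately show "p = r" unfolding B_def by (intro PiE_ext)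
  qed
  ultimately have "card (?D - {a}) \<le> card {q \<in> nonzero_box n T. frac (\<phi> q) \<le> h}"
    by (intro card_inj_on_le) (auto intro: finite_subset[OF _ finite_nonzero_box])
  moreover have "card ?D \<le> card (?D - {a}) + 1"
    using diff_card_le_card_Diff[of "{a}" ?D] by simp
  ultimately show ?thesis using ge B(2) by simp
qed

text \<open>Points whose linear form lies just to the right of an integer and their negatives are two
  disjoint families of the same size. At \<open>t = 2\<close> disjointness still holds because \<open>2 q \<cdot> \<alpha>\<close> is not
  an integer.\<close>

lemma card_small_dist_ge:
  fixes n :: nat and \<alpha> :: "nat \<Rightarrow> real" and t :: real
  defines "\<phi> \<equiv> \<lambda>q. \<Sum>j=1..n. of_int (q j) * \<alpha> j"
  assumes ind: "rat_lin_indep_family (\<lambda>j. if j = 0 then 1 else \<alpha> j) {0..n}"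
    and T: "\<And>j. j \<in> {1..n} \<Longrightarrow> T j > 0" and t: "t \<ge> 2"
  shows "2 * (real (\<Prod>j=1..n. T j) / t - 1) \<le>
    real (card {q \<in> nonzero_box n T. t \<le> inverse (dist_nearest_int (\<phi> q))})"
proof -
  let ?P = "{q \<in> nonzero_box n T. frac (\<phi> q) \<le> 1 / t}"
  let ?m = "\<lambda>q. \<lambda>j\<in>{1..n}. - q j"
  have notin: "\<phi> q \<notin> \<int>" if "q \<in> nonzero_box n T" for q
    using that linear_form_notin_Ints[OF ind] unfolding nonzero_box_def \<phi>_def by blast
  have neg: "\<phi> (?m q) = - \<phi> q" for q by (simp add: \<phi>_def sum_negf)
  have fin: "finite ?P" by (rule finite_subset[OF _ finite_nonzero_box]) auto
  have large: "t \<le> inverse (dist_nearest_int x)" if "x \<notin> \<int>" "dist_nearest_int x \<le> 1 / t" for x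
  proof -
    have "inverse (1 / t) \<le> inverse (dist_nearest_int x)"
      using that dist_nearest_int_pos by (intro le_imp_inverse_le) auto
    then show ?thesis by simp
  qed
  have disj: "?P \<inter> ?m ` ?P = {}"
  proof (rule ccontr)
    assume "?P \<inter> ?m ` ?P \<noteq> {}"
    then obtain q where q: "q \<in> ?P" "?m q \<in> ?P" by blast
    have "frac (\<phi> (?m q)) = 1 - frac (\<phi> q)"
      using notin q(1) unfolding neg by (simp add: frac_neg)
    moreover have "1 / t \<le> 1 / 2" using t by simp
    ultimately have "frac (\<phi> q) = 1 / 2" using q by auto
    then have "2 * \<phi> q = of_int (2 * \<lfloor>\<phi> q\<rfloor> + 1)" by (simp add: frac_def)
    moreover have "2 * \<phi> q = (\<Sum>j=1..n. of_int (2 * q j) * \<alpha> j)"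
      by (simp add: \<phi>_def sum_distrib_left mult.assoc)
    moreover obtain j where "j \<in> {1..n}" "q j \<noteq> 0" using q(1) by (auto simp: nonzero_box_def)
    ultimately show False
      using linear_form_notin_Ints[OF ind, of j "\<lambda>j. 2 * q j"]
      by (metis Ints_of_int mult_eq_0_iff zero_neq_numeral)
  qed
  have "?P \<union> ?m ` ?P \<subseteq> {q \<in> nonzero_box n T. t \<le> inverse (dist_nearest_int (\<phi> q))}"
  proof (intro Un_least subsetI CollectI conjI)
    fix q assume q: "q \<in> ?P"
    then show "q \<in> nonzero_box n T" by simp
    show "t \<le> inverse (dist_nearest_int (\<phi> q))"
      using q dist_nearest_int_le_frac[of "\<phi> q"] by (intro large notin) auto
  next
    fix r assume "r \<in> ?m ` ?P"
    then obtain q where q: "q \<in> ?P" "r = ?m q" by blast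
    then show r: "r \<in> nonzero_box n T" using nonzero_box_uminus by simp
    have "\<phi> r = - \<phi> q" using q neg by simp
    then have "dist_nearest_int (\<phi> r) \<le> frac (\<phi> q)"
      using dist_nearest_int_minus_le_frac[of "\<phi> q"] by simp
    then show "t \<le> inverse (dist_nearest_int (\<phi> r))"
      using q(1) r by (intro large notin) auto
  qed
  then have "card (?P \<union> ?m ` ?P) \<le> card {q \<in> nonzero_box n T. t \<le> inverse (dist_nearest_int (\<phi> q))}"
    by (intro card_mono) (auto intro: finite_subset[OF _ finite_nonzero_box])
  moreover have "card (?P \<union> ?m ` ?P) = 2 * card ?P"
  proof -
    have "card (?m ` ?P) = card ?P"
      by (rule card_image) (rule inj_on_subset[OF inj_on_uminus_nonzero_box], auto)
    then show ?thesis using card_Un_disjoint[OF fin finite_imageI[OF fin] disj] by simp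
  qed
  moreover have "1 / t * real (\<Prod>j=1..n. T j) - 1 \<le> real (card ?P)"
    using card_small_frac_ge[OF T, where h = "1 / t"] t unfolding \<phi>_def by simp
  ultimately show ?thesis by simp
qed

text \<open>The excluded zero tuple costs nothing, since replacing each \<open>2 T\<^sub>j + 1\<close> by \<open>2 T\<^sub>j\<close> already
  lowers the product by at least one.\<close>

lemma card_nonzero_box_ge:
  assumes "n \<ge> 1"
  shows "2 ^ n * (\<Prod>j=1..n. T j) \<le> card (nonzero_box n T)"
proof -
  let ?F = "\<Pi>\<^sub>E j\<in>{1..n}. {- int (T j)..int (T j)}"
  let ?z = "\<lambda>j\<in>{1..n}. 0::int"
  have "nonzero_box n T = ?F - {?z}"
  proof (intro equalityI subsetI)
    fix q assume "q \<in> nonzero_box n T"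
    then show "q \<in> ?F - {?z}"
      by (auto simp: nonzero_box_def PiE_iff abs_le_iff restrict_def)
  next
    fix q assume q: "q \<in> ?F - {?z}"
    have "\<exists>j\<in>{1..n}. q j \<noteq> 0"
    proof (rule ccontr)
      assume "\<not> ?thesis"
      moreover have "?z \<in> ?F" "q \<in> ?F" using q by auto
      ultimately have "q = ?z" by (intro PiE_ext[of q "{1..n}" _ ?z]) auto
      then show False using q by blast
    qed
    then show "q \<in> nonzero_box n T" using q
      by (auto simp: nonzero_box_def PiE_iff abs_le_iff)
  qed
  moreover have "?z \<in> ?F" by auto
  moreover have "finite ?F" by (intro finite_PiE) auto
  moreover have "card ?F = (\<Prod>j=1..n. 2 * T j + 1)"
    by (subst card_PiE) (auto intro!: prod.cong)
  ultimately have "card (nonzero_box n T) = (\<Prod>j=1..n. 2 * T j + 1) - 1" by simp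
  moreover have "(\<Prod>j=1..n. 2 * T j) < (\<Prod>j=1..n. 2 * T j + 1)"
    using assms by (cases "\<forall>j\<in>{1..n}. T j > 0") (auto intro!: prod_mono_strict)
  moreover have "(\<Prod>j=1..n. 2 * T j) = 2 ^ n * (\<Prod>j=1..n. T j)"
    by (simp add: prod.distrib)
  ultimately show ?thesis by linarith
qed

section \<open>The lower bound for the sum\<close>

theorem theorem1p3:
  fixes n :: nat and \<alpha> :: "nat \<Rightarrow> real" and T :: "nat \<Rightarrow> nat" and L :: real
  assumes "n \<ge> 1"
    and "rat_lin_indep_family (\<lambda>j. if j = 0 then 1 else \<alpha> j) {0..n}"
    and "\<And>j. j \<in> {1..n} \<Longrightarrow> T j > 0"
    and "(\<Prod>j=1..n. T j) \<ge> 2"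
    and "L \<ge> 2"
  shows "(\<Sum>q\<in>nonzero_box n T.
            min L (inverse (dist_nearest_int (\<Sum>j=1..n. of_int (q j) * \<alpha> j))))
         \<ge> 2 * real (\<Prod>j=1..n. T j) * min (ln L) (ln (real (\<Prod>j=1..n. T j)))
           + (2 ^ (n + 1) - 2 - ln 4) * real (\<Prod>j=1..n. T j) + 4"
proof -
  define M where "M = real (\<Prod>j=1..n. T j)"
  define K where "K = min L M"
  define B where "B = nonzero_box n T"
  define y where "y = (\<lambda>q. inverse (dist_nearest_int (\<Sum>j=1..n. of_int (q j) * \<alpha> j)))"
  have "M \<ge> 2" unfolding M_def using assms(4) by linarith
  then have K: "K \<ge> 2" "K \<le> L" "K \<le> M" using assms(5) by (auto simp: K_def)
  have finB: "finite B" by (simp add: B_def finite_nonzero_box)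
  have y: "y q \<ge> 2" if "q \<in> B" for q
  proof -
    let ?d = "dist_nearest_int (\<Sum>j=1..n. of_int (q j) * \<alpha> j)"
    obtain j where "j \<in> {1..n}" "q j \<noteq> 0"
      using \<open>q \<in> B\<close> unfolding B_def nonzero_box_def by blast
    then have "?d > 0" by (intro dist_nearest_int_pos linear_form_notin_Ints[OF assms(2)])
    then have "inverse (1 / 2) \<le> inverse ?d"
      using dist_nearest_int_le_half by (intro le_imp_inverse_le)
    then show ?thesis by (simp add: y_def)
  qed
  have layers: "((\<lambda>t. real (card {q \<in> B. t \<le> y q})) has_integral (\<Sum>q\<in>B. min K (y q) - 2)) {2..K}"
  proof -
    have "((\<lambda>t. if t \<le> y q then 1 else 0) has_integral (min K (y q) - 2)) {2..K}" if "q \<in> B" for q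
    proof -
      have "((\<lambda>t. if 2 \<le> t \<and> t \<le> y q then 1 else 0) has_integral (min K (y q) - 2)) {2..K}"
        using has_integral_indicator_interval[OF K(1), of 2 "y q"] y[OF that] K(1) by simp
      then show ?thesis by (rule has_integral_eq[rotated]) auto
    qed
    then have "((\<lambda>t. \<Sum>q\<in>B. if t \<le> y q then 1 else 0) has_integral (\<Sum>q\<in>B. min K (y q) - 2)) {2..K}"
      using finB by (intro has_integral_sum)
    moreover have "(\<Sum>q\<in>B. if t \<le> y q then 1 else 0) = real (card {q \<in> B. t \<le> y q})" for t
      using finB by (simp add: sum.If_cases Int_def)
    ultimately show ?thesis by simp
  qed
  have "((\<lambda>t. 2 * (M / t - 1)) has_integral (2 * (M * ln K - K) - 2 * (M * ln 2 - 2))) {2..K}"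
    using K(1)
    by (intro fundamental_theorem_of_calculus)
      (auto intro!: derivative_eq_intros simp: has_real_derivative_iff_has_vector_derivative[symmetric] field_simps)
  then have "2 * (M * ln K - K) - 2 * (M * ln 2 - 2) \<le> (\<Sum>q\<in>B. min K (y q) - 2)"
  proof (rule has_integral_le[OF _ layers])
    fix t assume "t \<in> {2..K}"
    then show "2 * (M / t - 1) \<le> real (card {q \<in> B. t \<le> y q})"
      using card_small_dist_ge[OF assms(2,3), where t = t] by (simp add: M_def B_def y_def)
  qed
  also have "\<dots> = (\<Sum>q\<in>B. min K (y q)) - 2 * real (card B)"
    by (simp add: sum_subtractf)
  also have "\<dots> \<le> (\<Sum>q\<in>B. min L (y q)) - 2 * real (card B)"
    using K(2) by (intro diff_right_mono sum_mono) (auto simp: min_def)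
  finally have "2 * (M * ln K - K) - 2 * (M * ln 2 - 2) + 2 * real (card B) \<le> (\<Sum>q\<in>B. min L (y q))"
    by simp
  moreover have "2 ^ n * M \<le> real (card B)"
  proof -
    have "real (2 ^ n * (\<Prod>j=1..n. T j)) \<le> real (card B)"
      unfolding B_def of_nat_le_iff by (rule card_nonzero_box_ge[OF assms(1)])
    then show ?thesis by (simp add: M_def)
  qed
  moreover have "ln 4 = 2 * ln (2::real)"
    using ln_realpow[of "2::real" 2] by simp
  moreover have "ln K = min (ln L) (ln M)"
    using assms(5) \<open>M \<ge> 2\<close> by (auto simp: K_def min_def)
  ultimately have "(\<Sum>q\<in>B. min L (y q)) \<ge> 2 * M * min (ln L) (ln M) + (2 ^ (n + 1) - 2 - ln 4) * M + 4"
    using K(3) by (simp add: algebra_simps)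
  then show ?thesis by (simp only: M_def B_def y_def)
qed

end
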